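(* For all positive integers $k$ and $N$, $$f(k,N)=\omega(KG(N,k) \cdot KG(N,k)).$$
   Context: The Kneser graph $KG(N,k)$ has as vertices the $k$-element subsets of a given $N$-element set, two vertices being connected if and only if the corresponding subsets are disjoint. The Xor product $G\cdot H$ of graphs $G,H$ is the graph with vertex set $V(G)\times V(H)$ in which two (distinct) vertices $(g,h)$ and $(g',h')$ are connected if and only if exactly one of the statements $gg'\in E(G)$ and $hh'\in E(H)$ holds. $\omega(G)$ denotes the clique number of $G$, i.e. the maximum size of a set of pairwise connected vertices. Let $k,N$ be positive integers and let $A,B$ be disjoint sets with $|A|=|B|=N$. For $S\subset A\cup B$ write $S_A=S\cap A$ and $S_B=S\cap B$. A family $\mathcal{S}$ of subsets of $A\cup B$ is called semiintersecting (with constants $k$ and $N$) if (i) $|S_A|=|S_B|=k$ for all $S\in\mathcal{S}$, and (ii) for all $S\neq T$ in $\mathcal{S}$, $S_A\cap T_A=\emptyset$ if and only if $S_B\cap T_B\neq\emptyset$. Define $f(k,N)$ to be the maximum of $|\mathcal{S}|$ over all semiintersecting families $\mathcal{S}$ with constants $k$ and $N$. *)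

theory Defs
  imports "Graph_Theory.Pair_Digraph"
begin

text \<open>
  Following the AFP entry Graph Theory, a finite simple graph is a loop-free symmetric digraph
  (\<^locale>\<open>pair_graph\<close>): an edge joining u and v is given by the two arcs (u, v) and (v, u).
\<close>

definition kneser_graph :: "'a set \<Rightarrow> nat \<Rightarrow> 'a set pair_pre_digraph" where
  "kneser_graph X k =
     \<lparr> pverts = {U. U \<subseteq> X \<and> card U = k},
       parcs = {(U, V). U \<subseteq> X \<and> card U = k \<and> V \<subseteq> X \<and> card V = k \<and> U \<noteq> V \<and> U \<inter> V = {}} \<rparr>"

definition xor_product ::
    "'a pair_pre_digraph \<Rightarrow> 'b pair_pre_digraph \<Rightarrow> ('a \<times> 'b) pair_pre_digraph" where
  "xor_product G H =
     \<lparr> pverts = pverts G \<times> pverts H,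
       parcs = {(u, v). u \<in> pverts G \<times> pverts H \<and> v \<in> pverts G \<times> pverts H \<and> u \<noteq> v \<and>
                  ((fst u, fst v) \<in> parcs G) \<noteq> ((snd u, snd v) \<in> parcs H)} \<rparr>"

definition clique :: "'a pair_pre_digraph \<Rightarrow> 'a set \<Rightarrow> bool" where
  "clique G C \<longleftrightarrow> C \<subseteq> pverts G \<and> (\<forall>u\<in>C. \<forall>v\<in>C. u \<noteq> v \<longrightarrow> (u, v) \<in> parcs G)"

text \<open>The maximum is meaningful for finite vertex sets only; the null graph has clique number 0.\<close>

definition clique_number :: "'a pair_pre_digraph \<Rightarrow> nat" where
  "clique_number G = Max {card C | C. clique G C}"

text \<open>
  The two disjoint ground sets A and B are parameters; the constant N is their common
  cardinality.
\<close>

definition semiintersecting :: "'a set \<Rightarrow> 'a set \<Rightarrow> nat \<Rightarrow> 'a set set \<Rightarrow> bool" where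
  "semiintersecting A B k \<S> \<longleftrightarrow>
     (\<forall>S\<in>\<S>. S \<subseteq> A \<union> B) \<and>
     (\<forall>S\<in>\<S>. card (S \<inter> A) = k \<and> card (S \<inter> B) = k) \<and>
     (\<forall>S\<in>\<S>. \<forall>T\<in>\<S>. S \<noteq> T \<longrightarrow>
        ((S \<inter> A) \<inter> (T \<inter> A) = {} \<longleftrightarrow> (S \<inter> B) \<inter> (T \<inter> B) \<noteq> {}))"

text \<open>
  This is f(k, N) when A and B are disjoint and both of size N. The empty family is
  semiintersecting, so the maximum is over a nonempty set (and is 0 if k > N).
\<close>

definition max_semiintersecting :: "'a set \<Rightarrow> 'a set \<Rightarrow> nat \<Rightarrow> nat" where
  "max_semiintersecting A B k = Max {card \<S> | \<S>. semiintersecting A B k \<S>}"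

lemma pair_graph_kneser_graph:
  assumes "finite X"
  shows "pair_graph (kneser_graph X k)"
proof -
  have "finite (pverts (kneser_graph X k))"
    by (rule finite_subset[of _ "Pow X"]) (auto simp: kneser_graph_def assms)
  moreover have "finite (parcs (kneser_graph X k))"
    by (rule finite_subset[of _ "Pow X \<times> Pow X"]) (auto simp: kneser_graph_def assms)
  moreover have "sym (parcs (kneser_graph X k))"
    by (rule symI) (simp add: kneser_graph_def Int_commute eq_commute)
  ultimately show ?thesis
    by unfold_locales (simp_all add: kneser_graph_def symmetric_def split: prod.splits)
qed

lemma pair_graph_xor_product:
  assumes "pair_graph G" "pair_graph H"
  shows "pair_graph (xor_product G H)"
proof -
  interpret G: pair_graph G by fact
  interpret H: pair_graph H by fact
  have sym_G: "sym (parcs G)" and sym_H: "sym (parcs H)"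
    using G.pair_sym_arcs H.pair_sym_arcs by (simp_all add: symmetric_def)
  let ?P = "xor_product G H"
  have verts: "pverts ?P = pverts G \<times> pverts H"
    by (simp add: xor_product_def)
  have fin: "finite (pverts ?P)"
    unfolding verts by (intro finite_cartesian_product G.pair_finite_verts H.pair_finite_verts)
  have sub: "parcs ?P \<subseteq> pverts ?P \<times> pverts ?P"
    unfolding xor_product_def by (simp only: pair_pre_digraph.simps) blast
  have finP: "finite (parcs ?P)"
    by (rule finite_subset[OF sub finite_cartesian_product[OF fin fin]])
  have sym_P: "sym (parcs ?P)"
  proof (rule symI)
    fix u v assume "(u, v) \<in> parcs ?P"
    moreover have "(fst u, fst v) \<in> parcs G \<longleftrightarrow> (fst v, fst u) \<in> parcs G"
      using sym_G by (meson symD)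
    moreover have "(snd u, snd v) \<in> parcs H \<longleftrightarrow> (snd v, snd u) \<in> parcs H"
      using sym_H by (meson symD)
    ultimately show "(v, u) \<in> parcs ?P"
      by (simp add: xor_product_def eq_commute)
  qed
  have loopfree: "fst e \<noteq> snd e" if "e \<in> parcs ?P" for e
    using that by (simp add: xor_product_def split: prod.splits)
  show ?thesis
  proof unfold_locales
    fix e assume "e \<in> parcs ?P"
    then show "fst e \<in> pverts ?P" "snd e \<in> pverts ?P"
      using sub by (metis mem_Times_iff subsetD)+
  qed (use fin finP sym_P loopfree in \<open>simp_all add: symmetric_def\<close>)
qed

lemma clique_number_attained:
  assumes "finite (pverts G)"
  shows "\<exists>C. clique G C \<and> card C = clique_number G"
    and "clique G C \<Longrightarrow> card C \<le> clique_number G"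
proof -
  have fin: "finite {card C | C. clique G C}"
    by (rule finite_subset[of _ "card ` Pow (pverts G)"]) (auto simp: clique_def assms)
  have "clique G {}" by (simp add: clique_def)
  then have "clique_number G \<in> {card C | C. clique G C}"
    unfolding clique_number_def by (intro Max_in fin) auto
  then show "\<exists>C. clique G C \<and> card C = clique_number G" by auto
  show "clique G C \<Longrightarrow> card C \<le> clique_number G"
    unfolding clique_number_def by (intro Max_ge fin) auto
qed

lemma max_semiintersecting_attained:
  assumes "finite A" "finite B"
  shows "\<exists>\<S>. semiintersecting A B k \<S> \<and> card \<S> = max_semiintersecting A B k"
    and "semiintersecting A B k \<S> \<Longrightarrow> card \<S> \<le> max_semiintersecting A B k"
proof -
  have fin: "finite {card \<S> | \<S>. semiintersecting A B k \<S>}"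
    by (rule finite_subset[of _ "card ` Pow (Pow (A \<union> B))"])
      (auto simp: semiintersecting_def assms)
  have "semiintersecting A B k {}" by (simp add: semiintersecting_def)
  then have "max_semiintersecting A B k \<in> {card \<S> | \<S>. semiintersecting A B k \<S>}"
    unfolding max_semiintersecting_def by (intro Max_in fin) auto
  then show "\<exists>\<S>. semiintersecting A B k \<S> \<and> card \<S> = max_semiintersecting A B k" by auto
  show "semiintersecting A B k \<S> \<Longrightarrow> card \<S> \<le> max_semiintersecting A B k"
    unfolding max_semiintersecting_def by (intro Max_ge fin) auto
qed

end

theory Submission
  imports Defs
begin

text \<open>
  A set S inside A \<union> B is determined by its two traces S \<inter> A and S \<inter> B. After identifying each of
  A and B with X by a bijection, the sets with both traces of size k are therefore exactly the
  vertices of the Xor product of the Kneser graph on X with itself.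
  Condition (ii) of a semiintersecting family says that exactly one of the two pairs of traces is
  disjoint, which is adjacency in the Xor product. Hence semiintersecting families and cliques
  correspond under this identification, with the same cardinality, and the two maxima are taken
  over the same set of numbers.
\<close>

definition traces_image :: "('a \<Rightarrow> 'b) \<Rightarrow> ('a \<Rightarrow> 'c) \<Rightarrow> 'a set \<Rightarrow> 'a set \<Rightarrow> 'a set \<Rightarrow> 'b set \<times> 'c set"
  where "traces_image f g A B S = (f ` (S \<inter> A), g ` (S \<inter> B))"

definition balanced_sets :: "'a set \<Rightarrow> 'a set \<Rightarrow> nat \<Rightarrow> 'a set set" where
  "balanced_sets A B k = {S. S \<subseteq> A \<union> B \<and> card (S \<inter> A) = k \<and> card (S \<inter> B) = k}"

text \<open>
  For k > 0 a k-set is not disjoint from itself, so adjacency is disjointness even when U = V.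
  That case matters: distinct vertices of the Xor product may agree in one coordinate.
\<close>

lemma kneser_graph_adjacent_image_iff:
  assumes "0 < k" and f: "bij_betw f A X"
    and UV: "U \<subseteq> A" "V \<subseteq> A" "card U = k" "card V = k"
  shows "(f ` U, f ` V) \<in> parcs (kneser_graph X k) \<longleftrightarrow> U \<inter> V = {}"
proof -
  have inj: "inj_on f A" and im: "f ` A = X"
    using f by (auto simp: bij_betw_def)
  have "card (f ` U) = k" "card (f ` V) = k"
    using UV inj by (metis card_image inj_on_subset)+
  moreover have "f ` U \<subseteq> X" "f ` V \<subseteq> X"
    using UV im by auto
  moreover have "f ` U \<inter> f ` V = f ` (U \<inter> V)"
    using inj UV by (simp add: inj_on_image_Int)
  moreover have "f ` U \<noteq> f ` V" if "U \<inter> V = {}"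
    using that UV \<open>0 < k\<close> inj by (auto simp: inj_on_image_eq_iff)
  ultimately show ?thesis
    by (auto simp: kneser_graph_def)
qed

lemma bij_betw_traces_image:
  assumes disj: "A \<inter> B = {}" and f: "bij_betw f A X" and g: "bij_betw g B Y"
  shows "bij_betw (traces_image f g A B) (balanced_sets A B k)
           (pverts (xor_product (kneser_graph X k) (kneser_graph Y k)))"
proof -
  have f_inj: "inj_on f A" and f_im: "f ` A = X"
    and g_inj: "inj_on g B" and g_im: "g ` B = Y"
    using f g by (auto simp: bij_betw_def)
  have card_f: "card (f ` U) = card U" if "U \<subseteq> A" for U
    using that f_inj by (metis card_image inj_on_subset)
  have card_g: "card (g ` U) = card U" if "U \<subseteq> B" for U
    using that g_inj by (metis card_image inj_on_subset)
  have inj: "inj_on (traces_image f g A B) (balanced_sets A B k)"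
  proof (rule inj_onI)
    fix S T
    assume S: "S \<in> balanced_sets A B k" and T: "T \<in> balanced_sets A B k"
      and "traces_image f g A B S = traces_image f g A B T"
    then have "S \<inter> A = T \<inter> A" "S \<inter> B = T \<inter> B"
      using f_inj g_inj by (simp_all add: traces_image_def inj_on_image_eq_iff)
    with S T show "S = T"
      by (auto simp: balanced_sets_def)
  qed
  have "traces_image f g A B ` balanced_sets A B k
      = pverts (xor_product (kneser_graph X k) (kneser_graph Y k))" (is "?L = ?R")
  proof
    show "?L \<subseteq> ?R"
      using f_im g_im
      by (auto simp: traces_image_def balanced_sets_def xor_product_def kneser_graph_def
            card_f card_g)
    show "?R \<subseteq> ?L"
    proof
      fix p assume "p \<in> ?R"
      then obtain P Q where p: "p = (P, Q)" and P: "P \<subseteq> f ` A" "card P = k"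
        and Q: "Q \<subseteq> g ` B" "card Q = k"
        by (auto simp: xor_product_def kneser_graph_def f_im g_im)
      obtain U where U: "U \<subseteq> A" "P = f ` U"
        using P(1) by (rule subset_imageE)
      obtain V where V: "V \<subseteq> B" "Q = g ` V"
        using Q(1) by (rule subset_imageE)
      have traces: "(U \<union> V) \<inter> A = U" "(U \<union> V) \<inter> B = V"
        using U(1) V(1) disj by auto
      then have "U \<union> V \<in> balanced_sets A B k"
        using U V P(2) Q(2) by (auto simp: balanced_sets_def card_f card_g)
      moreover have "p = traces_image f g A B (U \<union> V)"
        by (simp add: p traces_image_def traces U(2) V(2))
      ultimately show "p \<in> ?L" by blast
    qed
  qed
  with inj show ?thesis by (simp add: bij_betw_def)
qed

lemma clique_traces_image_iff_semiintersecting: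
  assumes "0 < k" and "A \<inter> B = {}" and f: "bij_betw f A X" and g: "bij_betw g B Y"
    and \<S>: "\<S> \<subseteq> balanced_sets A B k"
  shows "clique (xor_product (kneser_graph X k) (kneser_graph Y k)) (traces_image f g A B ` \<S>)
           \<longleftrightarrow> semiintersecting A B k \<S>"
proof -
  let ?P = "xor_product (kneser_graph X k) (kneser_graph Y k)"
  let ?\<phi> = "traces_image f g A B"
  have bij: "bij_betw ?\<phi> (balanced_sets A B k) (pverts ?P)"
    using bij_betw_traces_image assms(2-4) .
  have inj: "inj_on ?\<phi> (balanced_sets A B k)"
    using bij by (simp add: bij_betw_def)
  have verts: "?\<phi> S \<in> pverts ?P" if "S \<in> balanced_sets A B k" for S
    using bij that by (rule bij_betw_apply)
  have adj: "(?\<phi> S, ?\<phi> T) \<in> parcs ?P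
      \<longleftrightarrow> (S \<inter> A \<inter> (T \<inter> A) = {} \<longleftrightarrow> S \<inter> B \<inter> (T \<inter> B) \<noteq> {})"
    if ST: "S \<in> \<S>" "T \<in> \<S>" "S \<noteq> T" for S T
  proof -
    have S: "S \<in> balanced_sets A B k" and T: "T \<in> balanced_sets A B k"
      using ST \<S> by auto
    have "?\<phi> S \<noteq> ?\<phi> T"
      using inj_onD[OF inj _ S T] ST(3) by blast
    moreover have "?\<phi> S \<in> pverts (kneser_graph X k) \<times> pverts (kneser_graph Y k)"
      and "?\<phi> T \<in> pverts (kneser_graph X k) \<times> pverts (kneser_graph Y k)"
      using verts[OF S] verts[OF T] by (simp_all add: xor_product_def)
    ultimately have "(?\<phi> S, ?\<phi> T) \<in> parcs ?P
        \<longleftrightarrow> ((f ` (S \<inter> A), f ` (T \<inter> A)) \<in> parcs (kneser_graph X k))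
           \<noteq> ((g ` (S \<inter> B), g ` (T \<inter> B)) \<in> parcs (kneser_graph Y k))"
      by (simp add: xor_product_def traces_image_def)
    also have "\<dots> \<longleftrightarrow> (S \<inter> A \<inter> (T \<inter> A) = {}) \<noteq> (S \<inter> B \<inter> (T \<inter> B) = {})"
    proof -
      have "(f ` (S \<inter> A), f ` (T \<inter> A)) \<in> parcs (kneser_graph X k) \<longleftrightarrow> S \<inter> A \<inter> (T \<inter> A) = {}"
        by (rule kneser_graph_adjacent_image_iff[OF \<open>0 < k\<close> f])
          (use S T in \<open>auto simp: balanced_sets_def\<close>)
      moreover have
        "(g ` (S \<inter> B), g ` (T \<inter> B)) \<in> parcs (kneser_graph Y k) \<longleftrightarrow> S \<inter> B \<inter> (T \<inter> B) = {}"
        by (rule kneser_graph_adjacent_image_iff[OF \<open>0 < k\<close> g])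
          (use S T in \<open>auto simp: balanced_sets_def\<close>)
      ultimately show ?thesis by simp
    qed
    finally show ?thesis by blast
  qed
  have "clique ?P (?\<phi> ` \<S>) \<longleftrightarrow> (\<forall>S\<in>\<S>. \<forall>T\<in>\<S>. ?\<phi> S \<noteq> ?\<phi> T \<longrightarrow> (?\<phi> S, ?\<phi> T) \<in> parcs ?P)"
    using image_subset_iff[of ?\<phi> \<S> "pverts ?P"] verts \<S> by (simp add: clique_def subset_iff)
  also have "\<dots> \<longleftrightarrow> (\<forall>S\<in>\<S>. \<forall>T\<in>\<S>. S \<noteq> T \<longrightarrow> (?\<phi> S, ?\<phi> T) \<in> parcs ?P)"
    using inj_on_eq_iff[OF inj_on_subset[OF inj \<S>]] by simp
  also have "\<dots> \<longleftrightarrow> (\<forall>S\<in>\<S>. \<forall>T\<in>\<S>. S \<noteq> T \<longrightarrow>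
      (S \<inter> A \<inter> (T \<inter> A) = {} \<longleftrightarrow> S \<inter> B \<inter> (T \<inter> B) \<noteq> {}))"
    by (intro ball_cong refl imp_cong adj)
  also have "\<dots> \<longleftrightarrow> semiintersecting A B k \<S>"
  proof -
    have "\<forall>S\<in>\<S>. S \<subseteq> A \<union> B" "\<forall>S\<in>\<S>. card (S \<inter> A) = k \<and> card (S \<inter> B) = k"
      using \<S> by (auto simp: balanced_sets_def)
    then show ?thesis
      unfolding semiintersecting_def by blast
  qed
  finally show ?thesis .
qed

theorem proposition1p7:
  fixes k N :: nat and A B :: "'a set" and X :: "'b set"
  assumes "0 < k" and "0 < N"
    and "A \<inter> B = {}" and "card A = N" and "card B = N"
    and "card X = N"
  shows "max_semiintersecting A B k
           = clique_number (xor_product (kneser_graph X k) (kneser_graph X k))"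
proof -
  \<comment> \<open>The cardinality of an infinite set is 0, so N > 0 makes the three ground sets finite.\<close>
  have "finite A" "finite B" "finite X"
    using assms(2,4-6) by (auto intro: card_ge_0_finite)
  then obtain f g where f: "bij_betw f A X" and g: "bij_betw g B X"
    using assms(4-6) by (metis finite_same_card_bij)
  let ?P = "xor_product (kneser_graph X k) (kneser_graph X k)"
  let ?\<phi> = "traces_image f g A B"
  have bij: "bij_betw ?\<phi> (balanced_sets A B k) (pverts ?P)"
    using bij_betw_traces_image assms(3) f g .
  note clique_iff = clique_traces_image_iff_semiintersecting[OF assms(1,3) f g]
  have card: "card (?\<phi> ` \<S>) = card \<S>" if "\<S> \<subseteq> balanced_sets A B k" for \<S>
    using bij that by (metis bij_betw_def card_image inj_on_subset)
  have "{card \<S> | \<S>. semiintersecting A B k \<S>} = {card C | C. clique ?P C}" (is "?L = ?R")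
  proof
    show "?L \<subseteq> ?R"
    proof
      fix n assume "n \<in> ?L"
      then obtain \<S> where n: "n = card \<S>" and semi: "semiintersecting A B k \<S>"
        by blast
      have sub: "\<S> \<subseteq> balanced_sets A B k"
        using semi by (auto simp: semiintersecting_def balanced_sets_def)
      then have "clique ?P (?\<phi> ` \<S>)"
        using clique_iff semi by blast
      with n card[OF sub] show "n \<in> ?R" by force
    qed
    show "?R \<subseteq> ?L"
    proof
      fix n assume "n \<in> ?R"
      then obtain C where n: "n = card C" and C: "clique ?P C"
        by blast
      have "C \<subseteq> ?\<phi> ` balanced_sets A B k"
        using C bij by (simp add: clique_def bij_betw_def)
      then obtain \<S> where sub: "\<S> \<subseteq> balanced_sets A B k" and img: "C = ?\<phi> ` \<S>"
        by (rule subset_imageE)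
      have "semiintersecting A B k \<S>"
        using clique_iff[OF sub] C img by simp
      with n card[OF sub] img show "n \<in> ?L" by auto
    qed
  qed
  then show ?thesis
    by (simp add: max_semiintersecting_def clique_number_def)
qed

end
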